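(* Let $(x,y,z)$ be the primitive Pythagorean triple generated by any predetermined positive odd integer $x \geq 1$ using the formula $$x=x,\qquad y=\frac{x^2}{2d}-\frac d2,\qquad z=\frac{x^2}{2d}+\frac d2$$ with $z-y=d=1$, and let $(x^m,y',z')$ be the primitive Pythagorean triple generated by $x^m$, $m\in\mathbb{N}$, $m\geq 2$, using the same formula (with $x^m$ in place of $x$ and $d_m$ in place of $d$) with $z'-y'=d_m=1$. Then $$y'=y\left[1+\sum_{p=1}^{m-1}x^{2p}\right],\qquad z'=y\left[1+\sum_{p=1}^{m-1}x^{2p}\right]+1,$$ for every $m\in\mathbb{N}$ with $m\geq 2$. Moreover, $$z\left[(-1)^{m-1}+\sum_{p=1}^{m-1}(-1)^{m-1-p}x^{2p}\right]=\begin{cases}y' & \text{if } m \text{ is even},\\ z' & \text{if } m \text{ is odd},\end{cases}$$ and $$z\left[(-1)^{m-1}+\sum_{p=1}^{m-1}(-1)^{m-1-p}x^{2p}\right]+(-1)^{m-2}=\begin{cases}z' & \text{if } m \text{ is even},\\ y' & \text{if } m \text{ is odd}.\end{cases}$$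
   Context: A Pythagorean triple is a triple $(x,y,z)$ of positive integers with $x^2+y^2=z^2$; it is called primitive if, in addition, $x,y,z$ are co-prime. For an odd positive integer $x$, the parameter $d$ in the generating formula ranges over the positive integers $d\le x$ that divide $x^2$, and the triple generated by $x$ with parameter $d$ is $\left(x,\ \frac{x^2}{2d}-\frac d2,\ \frac{x^2}{2d}+\frac d2\right)$, so that the difference of its last two entries is $d$. Likewise $d_m$ denotes the parameter used for the triple generated by the odd integer $x^m$. With $d=1$ and $d_m=1$ the formula reads $y=\frac{x^2-1}{2}$, $z=\frac{x^2+1}{2}$ and $y'=\frac{x^{2m}-1}{2}$, $z'=\frac{x^{2m}+1}{2}$. *)

theory Defs
  imports Complex_Main
begin

definition pythagorean_triple :: "int \<Rightarrow> int \<Rightarrow> int \<Rightarrow> bool" where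
  "pythagorean_triple x y z \<longleftrightarrow> x > 0 \<and> y > 0 \<and> z > 0 \<and> x\<^sup>2 + y\<^sup>2 = z\<^sup>2"

definition primitive_pythagorean_triple :: "int \<Rightarrow> int \<Rightarrow> int \<Rightarrow> bool" where
  "primitive_pythagorean_triple x y z \<longleftrightarrow> pythagorean_triple x y z \<and> gcd x (gcd y z) = 1"

text \<open>
  The triple (x, y, z) is generated by the odd integer x with parameter d.  The formula is read
  in the reals, so no division is truncated.  Positivity of y is not part of the definition:
  x = d = 1 generates the degenerate triple (1, 0, 1).
\<close>
definition generated_triple :: "int \<Rightarrow> int \<Rightarrow> int \<Rightarrow> int \<Rightarrow> bool" where
  "generated_triple d x y z \<longleftrightarrow>
     odd x \<and> x > 0 \<and> 0 < d \<and> d \<le> x \<and> d dvd x\<^sup>2 \<and>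
     real_of_int y = (real_of_int x)\<^sup>2 / (2 * real_of_int d) - real_of_int d / 2 \<and>
     real_of_int z = (real_of_int x)\<^sup>2 / (2 * real_of_int d) + real_of_int d / 2"

text \<open>The integers y and z in the formula do exist for every odd x and d = 1.\<close>
lemma generated_triple_one_exists:
  assumes "odd x" "x \<ge> 1"
  shows "\<exists>y z. generated_triple 1 x y z \<and> z - y = 1"
proof -
  from \<open>odd x\<close> obtain k where k: "x = 2 * k + 1" by (rule oddE)
  have "generated_triple 1 x (2 * k\<^sup>2 + 2 * k) (2 * k\<^sup>2 + 2 * k + 1)"
    using assms unfolding generated_triple_def k
    by (simp add: power2_eq_square field_simps)
  then show ?thesis by force
qed

end

theory Submission
  imports Defs
begin

text \<open>Put q = \<open>x\<^sup>2\<close>. Parameter 1 gives 2y = q - 1 and 2z = q + 1, and for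
  the power 2y' = q^m - 1 and 2z' = q^m + 1. Both product formulas are then the factorization of q^m
  - c^m by q - c (\<open>power_diff_eq_sum_from_1\<close>): c = 1 yields y', while c = -1 yields q^m
  - (-1)^m, which is 2y' or 2z' according to the parity of m. Since z' = y' + 1, adding the sign
  (-1)^(m-2) passes to the other of the two.\<close>

lemma generated_triple_one_double:
  assumes "generated_triple 1 x y z"
  shows "2 * y = x\<^sup>2 - 1" and "2 * z = x\<^sup>2 + 1"
proof -
  \<comment> \<open>Doubling clears the real denominators, so the equations descend to the
    integers.\<close>
  have "real_of_int (2 * y) = real_of_int (x\<^sup>2 - 1)" "real_of_int (2 * z) = real_of_int (x\<^sup>2 + 1)"
    using assms unfolding generated_triple_def by simp_all
  then show "2 * y = x\<^sup>2 - 1" and "2 * z = x\<^sup>2 + 1"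
    by (simp_all only: of_int_eq_iff)
qed

text \<open>Consecutive integers y and z are coprime. The bound x > 1 excludes the degenerate triple
  (1, 0, 1).\<close>

lemma generated_triple_one_primitive:
  assumes "generated_triple 1 x y z" and "x > 1"
  shows "primitive_pythagorean_triple x y z"
proof -
  note double = generated_triple_one_double[OF assms(1)]
  from double have z: "z = y + 1" by simp
  have "1 < x\<^sup>2"
    using \<open>x > 1\<close> by (simp add: one_less_power)
  then have "y > 0" using double by simp
  moreover have "x\<^sup>2 + y\<^sup>2 = z\<^sup>2"
    using double unfolding z by (simp add: power2_eq_square algebra_simps)
  moreover have "coprime y z" unfolding z by simp
  ultimately show ?thesis
    using \<open>x > 1\<close> z unfolding primitive_pythagorean_triple_def pythagorean_triple_def
    by (simp add: coprime_iff_gcd_eq_1)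
qed

text \<open>This is \<open>power_diff_sumr2\<close> with the term p = 0 split off, to match the
  shape of the sums in the theorem.\<close>

lemma power_diff_eq_sum_from_1:
  fixes q c :: "'a::comm_ring_1"
  assumes "m \<ge> 1"
  shows "(q - c) * (c ^ (m - 1) + (\<Sum>p = 1..m - 1. c ^ (m - 1 - p) * q ^ p)) = q ^ m - c ^ m"
proof -
  have "{..<m} = insert 0 {1..m - 1}"
    using assms by auto
  then have "(\<Sum>p<m. c ^ (m - Suc p) * q ^ p) =
      c ^ (m - 1) + (\<Sum>p = 1..m - 1. c ^ (m - 1 - p) * q ^ p)"
    by simp
  then show ?thesis
    by (simp add: power_diff_sumr2)
qed

theorem theorem2p1:
  fixes x y z y' z' d d\<^sub>m :: int and m :: nat
  assumes "odd x" and "x \<ge> 1" and "m \<ge> 2"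
    and "generated_triple d x y z" and "z - y = d" and "d = 1"
    and "generated_triple d\<^sub>m (x ^ m) y' z'" and "z' - y' = d\<^sub>m" and "d\<^sub>m = 1"
  shows "(x > 1 \<longrightarrow> primitive_pythagorean_triple x y z \<and>
                    primitive_pythagorean_triple (x ^ m) y' z') \<and>
    y' = y * (1 + (\<Sum>p = 1..m - 1. x ^ (2 * p))) \<and>
    z' = y * (1 + (\<Sum>p = 1..m - 1. x ^ (2 * p))) + 1 \<and>
    z * ((- 1) ^ (m - 1) + (\<Sum>p = 1..m - 1. (- 1) ^ (m - 1 - p) * x ^ (2 * p)))
      = (if even m then y' else z') \<and>
    z * ((- 1) ^ (m - 1) + (\<Sum>p = 1..m - 1. (- 1) ^ (m - 1 - p) * x ^ (2 * p))) + (- 1) ^ (m - 2)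
      = (if even m then z' else y')"
proof -
  have gen: "generated_triple 1 x y z" and gen': "generated_triple 1 (x ^ m) y' z'"
    using assms by simp_all
  note double = generated_triple_one_double[OF gen]
  have double': "2 * y' = (x\<^sup>2) ^ m - 1" "2 * z' = (x\<^sup>2) ^ m + 1"
    using generated_triple_one_double[OF gen'] by (simp_all add: mult.commute flip: power_mult)
  define S where "S = 1 + (\<Sum>p = 1..m - 1. x ^ (2 * p))"
  define A where "A = (- 1) ^ (m - 1) + (\<Sum>p = 1..m - 1. (- 1) ^ (m - 1 - p) * x ^ (2 * p))"
  have m: "m \<ge> 1" using \<open>m \<ge> 2\<close> by simp
  have "(x\<^sup>2 - 1) * S = (x\<^sup>2) ^ m - 1"
    using power_diff_eq_sum_from_1[OF m, of "x\<^sup>2" 1] by (simp add: S_def power_mult)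
  \<comment> \<open>Here \<open>x\<^sup>2 - 1\<close> is replaced by 2y; the common factor 2 is then
    cancelled.\<close>
  then have "2 * (y * S) = 2 * y'"
    using double double' by (metis mult.assoc)
  then have y': "y' = y * S" by simp
  have "(x\<^sup>2 + 1) * A = (x\<^sup>2) ^ m - (- 1) ^ m"
    using power_diff_eq_sum_from_1[OF m, of "x\<^sup>2" "- 1"] by (simp add: A_def power_mult)
  then have zA: "2 * (z * A) = (x\<^sup>2) ^ m - (- 1) ^ m"
    using double by (metis mult.assoc)
  have z': "z' = y' + 1" using double' by simp
  have alt: "z * A = (if even m then y' else z')"
    using zA double' by auto
  \<comment> \<open>As m \<ge> 2, the natural subtraction is exact and m - 2 has the parity of
    m.\<close>
  have sign: "(- 1) ^ (m - 2) = (if even m then 1 else - 1 :: int)"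
    using \<open>m \<ge> 2\<close> by simp
  have prim: "primitive_pythagorean_triple x y z \<and> primitive_pythagorean_triple (x ^ m) y' z'"
    if "x > 1"
    using generated_triple_one_primitive gen gen' that m by (simp add: one_less_power)
  show ?thesis
    unfolding S_def[symmetric] A_def[symmetric]
    using prim y' z' alt sign by auto
qed

end
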